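(* Let $\mathcal X,\mathcal Y,\mathcal Z$ be finite sets, $f:\mathcal X\times\mathcal Y\to\mathcal Z$, $\mu$ any distribution on $\mathcal X\times\mathcal Y$, and $0<\epsilon<1/2$. Then \[ \mathrm{IC}^{\mathrm{ext}}_\mu(f,0)-\mathrm{IC}^{\mathrm{ext}}_\mu(f,\epsilon)\le4|\mathcal X||\mathcal Y|\,h(\sqrt\epsilon). \]
   Context: $h$ is the binary entropy function (logs base 2). Two-party communication model: Alice gets $x$, Bob gets $y$; protocols may use public and private randomness; the transcript $\Pi$ consists of the public random string and all transmitted bits; the output $\pi(x,y)$ is determined by the transcript. For $(X,Y)\sim\mu$, $\mathrm{IC}^{\mathrm{ext}}_\mu(\pi)=I(\Pi;XY)$. A protocol performs $[f,\eta]$ if $\Pr[\pi(x,y)\ne f(x,y)]\le\eta$ for every $(x,y)$; $\mathrm{IC}^{\mathrm{ext}}_\mu(f,\eta)=\inf\{\mathrm{IC}^{\mathrm{ext}}_\mu(\pi):\pi\text{ performs }[f,\eta]\}$. *)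

theory Defs
  imports "HOL-Probability.Probability"
begin

definition bin_entropy :: "real \<Rightarrow> real" where
  "bin_entropy p = - p * log 2 p - (1 - p) * log 2 (1 - p)"

text \<open>A protocol tree (for a fixed value of the public random string).
  At an Alice node the bit sent is a function of Alice's input and her
  private random value; at a Bob node, of Bob's input and his private random
  value.  Bit False continues in the first subtree, True in the second.
  Leaves are labelled with the output.\<close>

datatype ('x, 'y, 'z) ptree =
    Leaf 'z
  | ANode "'x \<Rightarrow> nat \<Rightarrow> bool" "('x, 'y, 'z) ptree" "('x, 'y, 'z) ptree"
  | BNode "'y \<Rightarrow> nat \<Rightarrow> bool" "('x, 'y, 'z) ptree" "('x, 'y, 'z) ptree"

fun run_bits :: "('x, 'y, 'z) ptree \<Rightarrow> 'x \<Rightarrow> 'y \<Rightarrow> nat \<Rightarrow> nat \<Rightarrow> bool list" where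
  "run_bits (Leaf z) x y ra rb = []"
| "run_bits (ANode g l r) x y ra rb =
     (let b = g x ra in b # run_bits (if b then r else l) x y ra rb)"
| "run_bits (BNode g l r) x y ra rb =
     (let b = g y rb in b # run_bits (if b then r else l) x y ra rb)"

fun leaf_of :: "('x, 'y, 'z) ptree \<Rightarrow> bool list \<Rightarrow> 'z option" where
  "leaf_of (Leaf z) [] = Some z"
| "leaf_of (Leaf z) (b # bs) = None"
| "leaf_of (ANode g l r) [] = None"
| "leaf_of (ANode g l r) (b # bs) = leaf_of (if b then r else l) bs"
| "leaf_of (BNode g l r) [] = None"
| "leaf_of (BNode g l r) (b # bs) = leaf_of (if b then r else l) bs"

record ('x, 'y, 'z) protocol =
  pub_rand :: "nat pmf"
  privA_rand :: "nat pmf"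
  privB_rand :: "nat pmf"
  ptree :: "nat \<Rightarrow> ('x, 'y, 'z) ptree"

text \<open>The transcript: public random string together with all transmitted bits.\<close>
type_synonym transcript = "nat \<times> bool list"

definition transcript_of ::
  "('x, 'y, 'z) protocol \<Rightarrow> 'x \<Rightarrow> 'y \<Rightarrow> nat \<Rightarrow> nat \<Rightarrow> nat \<Rightarrow> transcript" where
  "transcript_of \<pi> x y r ra rb = (r, run_bits (ptree \<pi> r) x y ra rb)"

definition output_of :: "('x, 'y, 'z) protocol \<Rightarrow> transcript \<Rightarrow> 'z" where
  "output_of \<pi> t = the (leaf_of (ptree \<pi> (fst t)) (snd t))"

definition transcript_pmf :: "('x, 'y, 'z) protocol \<Rightarrow> 'x \<Rightarrow> 'y \<Rightarrow> transcript pmf" where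
  "transcript_pmf \<pi> x y =
     do { r \<leftarrow> pub_rand \<pi>; ra \<leftarrow> privA_rand \<pi>; rb \<leftarrow> privB_rand \<pi>;
          return_pmf (transcript_of \<pi> x y r ra rb) }"

definition joint_pmf :: "('x \<times> 'y) pmf \<Rightarrow> ('x, 'y, 'z) protocol \<Rightarrow> (('x \<times> 'y) \<times> transcript) pmf" where
  "joint_pmf \<mu> \<pi> = do { xy \<leftarrow> \<mu>; t \<leftarrow> transcript_pmf \<pi> (fst xy) (snd xy); return_pmf (xy, t) }"

definition IC_ext :: "('x \<times> 'y) pmf \<Rightarrow> ('x, 'y, 'z) protocol \<Rightarrow> real" where
  "IC_ext \<mu> \<pi> = prob_space.mutual_information (measure_pmf (joint_pmf \<mu> \<pi>)) 2
      (count_space UNIV) (count_space UNIV) snd fst"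

definition performs :: "('x, 'y, 'z) protocol \<Rightarrow> ('x \<Rightarrow> 'y \<Rightarrow> 'z) \<Rightarrow> real \<Rightarrow> bool" where
  "performs \<pi> f \<eta> \<longleftrightarrow>
     (\<forall>x y. measure_pmf.prob (transcript_pmf \<pi> x y) {t. output_of \<pi> t \<noteq> f x y} \<le> \<eta>)"

definition IC_ext_f :: "('x \<times> 'y) pmf \<Rightarrow> ('x \<Rightarrow> 'y \<Rightarrow> 'z) \<Rightarrow> real \<Rightarrow> real" where
  "IC_ext_f \<mu> f \<eta> = (INF \<pi> \<in> {\<pi> :: ('x, 'y, 'z) protocol. performs \<pi> f \<eta>}. IC_ext \<mu> \<pi>)"

end

theory Submission
  imports Defs
begin

text \<open>A protocol with error at most \<open>\<epsilon>\<close> is made errorless one input pair \<open>(x0, y0)\<close> at a time. After a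
  transcript \<open>t\<close> whose output is wrong for \<open>(x0, y0)\<close>, the player whose part of that pair is less likely
  given \<open>t\<close> says whether she or he holds it; only if so, the other one does the same, and if both do
  they output \<open>f x0 y0\<close>. Since \<open>P(t | x, y) = a(x) b(y)\<close>, Cauchy-Schwarz gives
  \<open>\<Sum>\<^sub>t min(P(t, X = x0), P(t, Y = y0)) \<le> \<surd>\<epsilon>\<close> over the wrong transcripts, so a first yes has
  probability at most \<open>\<surd>\<epsilon>\<close>. Predicting the first answer by a coin of bias \<open>c = min(\<surd>\<epsilon>, 1/2)\<close> and the
  second by a fair coin shows that the new bits reveal at most \<open>4 h(\<surd>\<epsilon>)\<close> bits of information.\<close>

subsection \<open>Mutual information of a pair distribution\<close>

text \<open>Weighting by \<open>q\<close> cancels the denominator and leaves the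
  \<open>p\<close>-mass of the support of \<open>q\<close>. Mass of \<open>p\<close> outside that
  support is lost, hence an inequality.\<close>

lemma pmf_ratio_expectation:
  fixes p q :: "'a pmf"
  shows "integrable (measure_pmf q) (\<lambda>x. pmf p x / pmf q x)"
    and "measure_pmf.expectation q (\<lambda>x. pmf p x / pmf q x) \<le> 1"
proof -
  have bound: "norm (pmf q x *\<^sub>R (pmf p x / pmf q x)) \<le> norm (pmf p x)" for x
    by (cases "pmf q x = 0") auto
  have int: "integrable (count_space UNIV) (\<lambda>x. pmf q x *\<^sub>R (pmf p x / pmf q x))"
    by (rule Bochner_Integration.integrable_bound[OF integrable_pmf[of UNIV p]]) (use bound in auto)
  then show "integrable (measure_pmf q) (\<lambda>x. pmf p x / pmf q x)"
    unfolding measure_pmf_eq_density[of q] by (subst integrable_density) auto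
  have "measure_pmf.expectation q (\<lambda>x. pmf p x / pmf q x)
      = (\<integral>x. pmf q x *\<^sub>R (pmf p x / pmf q x) \<partial>count_space UNIV)"
    by (subst measure_pmf_eq_density[of q], subst integral_density) auto
  also have "\<dots> \<le> (\<integral>x. pmf p x \<partial>count_space UNIV)"
  proof (rule integral_mono[OF int integrable_pmf])
    show "pmf q x *\<^sub>R (pmf p x / pmf q x) \<le> pmf p x" for x
      by (cases "pmf q x = 0") auto
  qed
  also have "\<dots> = 1"
    by (simp add: integral_pmf)
  finally show "measure_pmf.expectation q (\<lambda>x. pmf p x / pmf q x) \<le> 1" .
qed

lemma log2_le_minus_one:
  assumes "0 < (u::real)"
  shows "log 2 u \<le> (u - 1) / ln 2"
  using ln_le_minus_one[OF assms] by (simp add: log_def divide_right_mono)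

text \<open>Makes the relative entropy of \<open>q\<close> with respect to \<open>p\<close> well
  defined. Domination bounds the logarithm above by a constant, and \<open>log2_le_minus_one\<close>
  applied to \<open>p / q\<close> bounds it below by an integrable function whose expectation is
  nonnegative.\<close>

lemma log2_pmf_ratio:
  fixes p q :: "'a pmf"
  assumes dom: "\<And>x. x \<in> set_pmf q \<Longrightarrow> pmf q x \<le> C * pmf p x"
  shows "integrable (measure_pmf q) (\<lambda>x. log 2 (pmf q x / pmf p x))"
    and "0 \<le> measure_pmf.expectation q (\<lambda>x. log 2 (pmf q x / pmf p x))"
proof -
  have pos: "0 < pmf q x" "0 < pmf p x" if "x \<in> set_pmf q" for x
  proof -
    show "0 < pmf q x" using that by (simp add: pmf_positive)
    with dom[OF that] show "0 < pmf p x"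
      by (metis less_le_not_le mult_zero_right not_less_iff_gr_or_eq pmf_nonneg)
  qed
  have lower: "(1 - pmf p x / pmf q x) / ln 2 \<le> log 2 (pmf q x / pmf p x)" if "x \<in> set_pmf q" for x
    using log2_le_minus_one[of "pmf p x / pmf q x"] pos[OF that]
    by (simp add: log_divide field_simps)
  have upper: "log 2 (pmf q x / pmf p x) \<le> \<bar>log 2 C\<bar>" if "x \<in> set_pmf q" for x
  proof -
    have "pmf q x / pmf p x \<le> C"
      using dom[OF that] pos[OF that] by (simp add: field_simps)
    moreover have "0 < pmf q x / pmf p x" using pos[OF that] by simp
    ultimately have "log 2 (pmf q x / pmf p x) \<le> log 2 C"
      by (simp add: log_mono)
    then show ?thesis by linarith
  qed
  have "norm (log 2 (pmf q x / pmf p x)) \<le> norm (\<bar>log 2 C\<bar> + 1 / ln 2 + (pmf p x / pmf q x) / ln 2)"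
    if "x \<in> set_pmf q" for x
  proof -
    have "0 \<le> (pmf p x / pmf q x) / ln 2" by simp
    moreover have "0 \<le> 1 / ln (2::real)" by simp
    ultimately show ?thesis
      using lower[OF that] upper[OF that] unfolding diff_divide_distrib real_norm_def by linarith
  qed
  then have "AE x in measure_pmf q. norm (log 2 (pmf q x / pmf p x))
      \<le> norm (\<bar>log 2 C\<bar> + 1 / ln 2 + (pmf p x / pmf q x) / ln 2)"
    unfolding AE_measure_pmf_iff by blast
  moreover have "integrable (measure_pmf q) (\<lambda>x. \<bar>log 2 C\<bar> + 1 / ln 2 + (pmf p x / pmf q x) / ln 2)"
    by (intro Bochner_Integration.integrable_add integrable_divide pmf_ratio_expectation) simp_all
  ultimately show int: "integrable (measure_pmf q) (\<lambda>x. log 2 (pmf q x / pmf p x))"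
    by (rule Bochner_Integration.integrable_bound[rotated 2]) simp
  have "0 \<le> (1 - measure_pmf.expectation q (\<lambda>x. pmf p x / pmf q x)) / ln 2"
    using pmf_ratio_expectation(2)[where q = q and p = p] by simp
  also have "\<dots> = measure_pmf.expectation q (\<lambda>x. (1 - pmf p x / pmf q x) / ln 2)"
    using pmf_ratio_expectation(1)[where q = q and p = p] by simp
  also have "\<dots> \<le> measure_pmf.expectation q (\<lambda>x. log 2 (pmf q x / pmf p x))"
    using pmf_ratio_expectation(1)[where q = q and p = p] int lower
    by (intro integral_mono_AE) (auto simp: AE_measure_pmf_iff)
  finally show "0 \<le> measure_pmf.expectation q (\<lambda>x. log 2 (pmf q x / pmf p x))" .
qed

text \<open>On countable types the product of discrete sigma-algebras is discrete, so it suffices to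
  compare densities.\<close>

lemma measure_pmf_pair:
  fixes A :: "'a::countable pmf" and B :: "'b::countable pmf"
  shows "measure_pmf A \<Otimes>\<^sub>M measure_pmf B = measure_pmf (pair_pmf A B)"
proof -
  interpret B: sigma_finite_measure "density (count_space UNIV) (\<lambda>x. ennreal (pmf B x))"
    unfolding measure_pmf_eq_density[symmetric] by unfold_locales
  interpret C: sigma_finite_measure "count_space UNIV :: 'b measure"
    by (rule sigma_finite_measure_count_space)
  have "measure_pmf A \<Otimes>\<^sub>M measure_pmf B =
      density (count_space UNIV \<Otimes>\<^sub>M count_space UNIV) (\<lambda>(x, y). ennreal (pmf A x) * ennreal (pmf B y))"
    unfolding measure_pmf_eq_density[of A] measure_pmf_eq_density[of B]
    by (rule pair_measure_density) (auto intro: C.sigma_finite_measure_axioms B.sigma_finite_measure_axioms)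
  also have "\<dots> = measure_pmf (pair_pmf A B)"
    by (auto simp: pair_measure_countable measure_pmf_eq_density[of "pair_pmf A B"] pmf_pair ennreal_mult
        intro!: arg_cong2[where f = density])
  finally show ?thesis .
qed

text \<open>The relative entropy of \<open>J\<close> with respect to the product of its marginals.
  As an expectation over \<open>J\<close> it can be estimated pointwise on the support of
  \<open>J\<close>.\<close>

definition pmf_information :: "('a \<times> 't) pmf \<Rightarrow> real" where
  "pmf_information J = measure_pmf.expectation J
     (\<lambda>z. log 2 (pmf J z / (pmf (map_pmf fst J) (fst z) * pmf (map_pmf snd J) (snd z))))"

text \<open>Mutual information is a KL divergence, and symmetry absorbs the order
  \<open>snd fst\<close>, which is why the swapped distribution appears in the proof.\<close>

lemma mutual_information_pmf:
  fixes J :: "('a::countable \<times> 't::countable) pmf"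
  shows "prob_space.mutual_information (measure_pmf J) 2 (count_space UNIV) (count_space UNIV) snd fst
    = pmf_information J"
proof -
  let ?K = "map_pmf prod.swap J"
  let ?P = "pair_pmf (map_pmf snd J) (map_pmf fst J)"
  interpret C: sigma_finite_measure "count_space UNIV :: ('t \<times> 'a) measure"
    by (rule sigma_finite_measure_count_space)
  have K: "distr (measure_pmf J) (count_space UNIV \<Otimes>\<^sub>M count_space UNIV) (\<lambda>x. (snd x, fst x)) = measure_pmf ?K"
    unfolding map_pmf_rep_eq pair_measure_countable[OF countableI_type countableI_type] UNIV_Times_UNIV
    by (rule arg_cong[where f = "distr _ _"]) (simp add: fun_eq_iff)
  have marg: "map_pmf fst ?K = map_pmf snd J" "map_pmf snd ?K = map_pmf fst J"
    by (simp_all add: pmf.map_comp o_def)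
  have "pmf ?K z = 0" if "pmf ?P z = 0" for z
  proof -
    have "fst z \<notin> set_pmf (map_pmf fst ?K) \<or> snd z \<notin> set_pmf (map_pmf snd ?K)"
      using that unfolding marg by (cases z) (auto simp: pmf_pair pmf_eq_0_set_pmf)
    then have "z \<notin> set_pmf ?K" by auto
    then show ?thesis by (simp add: pmf_eq_0_set_pmf)
  qed
  then have "KL_divergence 2 (measure_pmf ?P) (measure_pmf ?K)
      = (\<integral>z. pmf ?K z * log 2 (pmf ?K z / pmf ?P z) \<partial>count_space UNIV)"
    unfolding measure_pmf_eq_density[of ?P] measure_pmf_eq_density[of ?K]
    by (intro C.KL_density_density) auto
  also have "\<dots> = measure_pmf.expectation ?K (\<lambda>z. log 2 (pmf ?K z / pmf ?P z))"
    by (subst measure_pmf_eq_density[of ?K], subst integral_density) auto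
  also have "\<dots> = measure_pmf.expectation J (\<lambda>z. log 2 (pmf ?K (prod.swap z) / pmf ?P (prod.swap z)))"
    by simp
  also have "\<dots> = pmf_information J"
    unfolding pmf_information_def pmf_map_inj'[OF inj_swap]
    by (intro Bochner_Integration.integral_cong refl) (auto simp: pmf_pair prod.swap_def mult.commute)
  finally show ?thesis
    unfolding prob_space.mutual_information_def[OF prob_space_measure_pmf] K
    by (simp add: map_pmf_rep_eq[symmetric] measure_pmf_pair)
qed

text \<open>The first component takes finitely many values, so its least positive probability
  \<open>c\<close> exists, and \<open>1 / c\<close> serves as the domination constant although there
  may be infinitely many transcripts.\<close>

lemma pmf_information_integrable:
  fixes J :: "('a::finite \<times> 't) pmf"
  shows "integrable (measure_pmf J)
      (\<lambda>z. log 2 (pmf J z / (pmf (map_pmf fst J) (fst z) * pmf (map_pmf snd J) (snd z))))"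
    and "0 \<le> pmf_information J"
proof -
  let ?P = "pair_pmf (map_pmf fst J) (map_pmf snd J)"
  define c where "c = Min (pmf (map_pmf fst J) ` set_pmf (map_pmf fst J))"
  have fin: "finite (set_pmf (map_pmf fst J))" by simp
  have ne: "set_pmf (map_pmf fst J) \<noteq> {}" by (rule set_pmf_not_empty)
  have c_pos: "0 < c"
    unfolding c_def by (subst Min_gr_iff) (use fin ne in \<open>auto simp del: set_map_pmf simp: pmf_positive\<close>)
  have "pmf J z \<le> (1 / c) * pmf ?P z" if "z \<in> set_pmf J" for z
  proof -
    have "fst z \<in> set_pmf (map_pmf fst J)" using that by simp
    then have c_le: "c \<le> pmf (map_pmf fst J) (fst z)"
      unfolding c_def using fin by (intro Min_le) (auto simp del: set_map_pmf)
    have "pmf J z = measure_pmf.prob J {z}" by (simp add: measure_pmf_single)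
    also have "\<dots> \<le> measure_pmf.prob J (snd -` {snd z})"
      by (intro measure_pmf.finite_measure_mono) auto
    also have "\<dots> = pmf (map_pmf snd J) (snd z)" by (simp add: pmf_map)
    finally have "pmf J z \<le> pmf (map_pmf snd J) (snd z)" .
    moreover have "c * pmf (map_pmf snd J) (snd z) \<le> pmf ?P z"
      using c_le by (cases z) (auto simp: pmf_pair intro!: mult_right_mono)
    ultimately show ?thesis using c_pos
      by (simp add: field_simps) (smt (verit) mult_left_mono mult.commute)
  qed
  note * = log2_pmf_ratio[where q = J and p = ?P, OF this]
  have P: "pmf ?P z = pmf (map_pmf fst J) (fst z) * pmf (map_pmf snd J) (snd z)" for z
    by (cases z) (simp add: pmf_pair)
  show "integrable (measure_pmf J)
      (\<lambda>z. log 2 (pmf J z / (pmf (map_pmf fst J) (fst z) * pmf (map_pmf snd J) (snd z))))"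
    using *(1) unfolding P .
  show "0 \<le> pmf_information J"
    using *(2) unfolding P pmf_information_def .
qed

text \<open>A Gibbs inequality: the exact marginal of the extended second component may be replaced by
  any distribution \<open>R\<close>, and the cost of the extension is the log-loss \<open>l\<close> of predicting it by \<open>R\<close>.\<close>

lemma pmf_information_extend:
  fixes J :: "('a::finite \<times> 't) pmf" and R :: "'t pmf"
  assumes inj: "inj_on (\<lambda>z. (fst z, G z)) (set_pmf J)"
    and R: "\<And>z. z \<in> set_pmf J \<Longrightarrow> pmf (map_pmf snd J) (snd z) * 2 powr (- l z) \<le> pmf R (G z)"
    and l: "integrable (measure_pmf J) l"
  shows "pmf_information (map_pmf (\<lambda>z. (fst z, G z)) J) \<le> pmf_information J + measure_pmf.expectation J l"
proof -
  let ?J' = "map_pmf (\<lambda>z. (fst z, G z)) J"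
  let ?P = "map_pmf snd J" and ?P' = "map_pmf G J" and ?\<mu> = "map_pmf fst J"
  let ?v = "\<lambda>z. log 2 (pmf J z / (pmf ?\<mu> (fst z) * pmf ?P (snd z)))"
  let ?v' = "\<lambda>z. log 2 (pmf ?J' (fst z, G z) / (pmf ?\<mu> (fst z) * pmf ?P' (G z)))"
  \<comment> \<open>The likelihood ratio of the guess \<open>R\<close> to the true marginal. Its
    expectation is at most 1, so the tangent bound on its logarithm contributes nothing positive at
    the end.\<close>
  let ?w = "\<lambda>z. pmf R (G z) / pmf ?P' (G z)"
  have marg: "map_pmf fst ?J' = ?\<mu>" "map_pmf snd ?J' = ?P'"
    by (simp_all add: pmf.map_comp o_def)
  \<comment> \<open>Injectivity means that no atoms of \<open>J\<close> merge, so only the second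
    marginal changes.\<close>
  have J': "pmf ?J' (fst z, G z) = pmf J z" if "z \<in> set_pmf J" for z
    using pmf_map_inj[OF inj that] by simp
  have int_v: "integrable (measure_pmf J) ?v" by (rule pmf_information_integrable)
  have int_v': "integrable (measure_pmf J) ?v'"
    using pmf_information_integrable(1)[of ?J'] unfolding marg by simp
  have int_w: "integrable (measure_pmf J) ?w"
    using pmf_ratio_expectation(1)[of ?P' R] by simp
  have w_le: "measure_pmf.expectation J ?w \<le> 1"
    using pmf_ratio_expectation(2)[of ?P' R] by simp
  have "pmf_information ?J' = measure_pmf.expectation J ?v'"
    unfolding pmf_information_def marg by simp
  also have "\<dots> \<le> measure_pmf.expectation J (\<lambda>z. ?v z + l z + (?w z - 1) / ln 2)"
  proof (intro integral_mono_AE int_v' Bochner_Integration.integrable_add int_v l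
      integrable_divide Bochner_Integration.integrable_diff int_w)
    have "?v' z \<le> ?v z + l z + (?w z - 1) / ln 2" if z: "z \<in> set_pmf J" for z
    proof -
      have pos: "0 < pmf J z" "0 < pmf ?\<mu> (fst z)" "0 < pmf ?P (snd z)" "0 < pmf ?P' (G z)"
        using z by (auto intro!: pmf_positive)
      then have "0 < pmf ?P (snd z) * 2 powr (- l z)" by simp
      with R[OF z] have R_pos: "0 < pmf R (G z)" by linarith
      have "log 2 (pmf ?P (snd z) * 2 powr (- l z)) \<le> log 2 (pmf R (G z))"
        using R[OF z] pos by (intro log_mono) auto
      then have 1: "log 2 (pmf ?P (snd z)) - l z \<le> log 2 (pmf R (G z))"
        using pos by (simp add: log_mult)
      have 2: "log 2 (pmf R (G z)) - log 2 (pmf ?P' (G z)) \<le> (?w z - 1) / ln 2"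
        using log2_le_minus_one[of "?w z"] pos R_pos by (simp add: log_divide)
      show ?thesis
        unfolding J'[OF z] using pos 1 2 by (simp add: log_divide log_mult)
    qed
    then show "AE z in measure_pmf J. ?v' z \<le> ?v z + l z + (?w z - 1) / ln 2"
      by (simp add: AE_measure_pmf_iff)
  qed simp
  also have "\<dots> = pmf_information J + measure_pmf.expectation J l + (measure_pmf.expectation J ?w - 1) / ln 2"
    using int_v l int_w by (simp add: pmf_information_def)
  also have "\<dots> \<le> pmf_information J + measure_pmf.expectation J l"
    using w_le by (simp add: divide_nonpos_pos)
  finally show ?thesis .
qed

subsection \<open>Protocol trees and transcripts\<close>

lemma pmf_bind_Pair:
  "pmf (bind_pmf P (\<lambda>r. map_pmf (Pair r) (Q r))) (r, w) = pmf P r * pmf (Q r) w"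
proof -
  have "pmf (map_pmf (Pair r') (Q r')) (r, w) = (if r' = r then pmf (Q r) w else 0)" for r'
  proof (cases "r' = r")
    case True
    then show ?thesis by (simp add: pmf_map_inj' inj_on_def)
  next
    case False
    then have "(r, w) \<notin> set_pmf (map_pmf (Pair r') (Q r'))" by auto
    then show ?thesis using False by (simp add: pmf_eq_0_set_pmf)
  qed
  then show ?thesis
    by (subst pmf_bind, subst integral_measure_pmf_real[where A = "{r}"]) (auto split: if_splits)
qed

text \<open>One summand of a mixture is at most the whole. This bounds a guess distribution below by
  the contribution of the true transcript alone.\<close>

lemma pmf_bind_ge: "pmf P x * pmf (Q x) y \<le> pmf (bind_pmf P Q) y"
proof -
  have "ennreal (pmf P x * pmf (Q x) y) = (\<integral>\<^sup>+x'. ennreal (pmf (Q x) y) * indicator {x} x' \<partial>measure_pmf P)"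
    by (subst nn_integral_cmult) (auto simp: emeasure_pmf_single ennreal_mult mult.commute)
  also have "\<dots> \<le> (\<integral>\<^sup>+x'. ennreal (pmf (Q x') y) \<partial>measure_pmf P)"
    by (intro nn_integral_mono) (auto split: split_indicator)
  also have "\<dots> = ennreal (pmf (bind_pmf P Q) y)"
    by (simp add: ennreal_pmf_bind)
  finally show ?thesis by simp
qed

text \<open>The continuation receives the path to the leaf as well as its label, because who is
  asked first depends on the whole transcript.\<close>

fun graft :: "('x, 'y, 'z) ptree \<Rightarrow> (bool list \<Rightarrow> 'z \<Rightarrow> ('x, 'y, 'z) ptree) \<Rightarrow> ('x, 'y, 'z) ptree" where
  "graft (Leaf z) k = k [] z"
| "graft (ANode g l r) k = ANode g (graft l (\<lambda>w. k (False # w))) (graft r (\<lambda>w. k (True # w)))"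
| "graft (BNode g l r) k = BNode g (graft l (\<lambda>w. k (False # w))) (graft r (\<lambda>w. k (True # w)))"

lemma leaf_of_run_bits: "leaf_of T (run_bits T x y ra rb) \<noteq> None"
  by (induction T) (auto simp: Let_def)

text \<open>Root-to-leaf paths form a prefix code, so bits appended to a transcript can be split off
  again.\<close>

lemma leaf_of_prefix_free:
  "leaf_of T w \<noteq> None \<Longrightarrow> leaf_of T w' \<noteq> None \<Longrightarrow> w @ v = w' @ v' \<Longrightarrow> w = w'"
proof (induction T arbitrary: w w')
  case (Leaf z)
  then show ?case by (cases w; cases w') auto
next
  case (ANode g l r)
  then show ?case by (cases w; cases w') (auto split: if_splits)
next
  case (BNode g l r)
  then show ?case by (cases w; cases w') (auto split: if_splits)
qed

lemma run_bits_graft: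
  "run_bits (graft T k) x y ra rb =
     (let w = run_bits T x y ra rb in w @ run_bits (k w (the (leaf_of T w))) x y ra rb)"
  by (induction T arbitrary: k) (auto simp: Let_def)

lemma leaf_of_graft:
  "leaf_of T w = Some z \<Longrightarrow> leaf_of (graft T k) (w @ v) = leaf_of (k w z) v"
proof (induction T arbitrary: w k)
  case (Leaf z)
  then show ?case by (cases w) auto
next
  case (ANode g l r)
  then show ?case by (cases w) (auto split: if_splits)
next
  case (BNode g l r)
  then show ?case by (cases w) (auto split: if_splits)
qed

text \<open>Along the common path the mixed run answers each Alice node as the first run does and
  each Bob node as the second does.\<close>

lemma run_bits_cut_and_paste:
  "run_bits T x y ra rb = w \<Longrightarrow> run_bits T x' y' ra' rb' = w \<Longrightarrow> run_bits T x y' ra rb' = w"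
  by (induction T arbitrary: w) (auto simp: Let_def split: if_splits)

section \<open>Likelihoods of transcripts\<close>

lemma pmf_transcript:
  "pmf (transcript_pmf \<pi> x y) (r, w) = pmf (pub_rand \<pi>) r *
     measure_pmf.prob (pair_pmf (privA_rand \<pi>) (privB_rand \<pi>))
       {(ra, rb). run_bits (ptree \<pi> r) x y ra rb = w}"
proof -
  have "transcript_pmf \<pi> x y = bind_pmf (pub_rand \<pi>) (\<lambda>r. map_pmf (Pair r)
     (map_pmf (\<lambda>(ra, rb). run_bits (ptree \<pi> r) x y ra rb) (pair_pmf (privA_rand \<pi>) (privB_rand \<pi>))))"
    by (simp add: transcript_pmf_def transcript_of_def pair_pmf_def map_bind_pmf)
  then show ?thesis
    by (simp add: pmf_bind_Pair pmf_map vimage_def case_prod_beta')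
qed

text \<open>For a fixed transcript the set of consistent private strings is a rectangle, so the
  likelihood of the transcript is a function of \<open>x\<close> times a function of \<open>y\<close>.\<close>

lemma transcript_factorization:
  fixes \<pi> :: "('x, 'y, 'z) protocol"
  obtains a :: "transcript \<Rightarrow> 'x \<Rightarrow> real" and b :: "transcript \<Rightarrow> 'y \<Rightarrow> real"
  where "\<And>t x. 0 \<le> a t x" "\<And>t y. 0 \<le> b t y"
    and "\<And>x y t. pmf (transcript_pmf \<pi> x y) t = a t x * b t y"
proof -
  \<comment> \<open>The other player's input and private string are quantified away; cut and paste
    shows that the product of the two sets is still exactly the consistent set.\<close>
  define SA where "SA t x = {ra. \<exists>y rb. run_bits (ptree \<pi> (fst t)) x y ra rb = snd t}" for t :: transcript and x
  define SB where "SB t y = {rb. \<exists>x ra. run_bits (ptree \<pi> (fst t)) x y ra rb = snd t}" for t :: transcript and y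
  \<comment> \<open>The probability of the public string is counted once, on Alice's side.\<close>
  define a where "a t x = pmf (pub_rand \<pi>) (fst t) * measure_pmf.prob (privA_rand \<pi>) (SA t x)" for t x
  define b where "b t y = measure_pmf.prob (privB_rand \<pi>) (SB t y)" for t y
  show ?thesis
  proof
    show "0 \<le> a t x" "0 \<le> b t y" for t x y
      by (simp_all add: a_def b_def)
    have rect: "{(ra, rb). run_bits (ptree \<pi> (fst t)) x y ra rb = snd t} = SA t x \<times> SB t y" for t x y
      by (auto simp: SA_def SB_def intro: run_bits_cut_and_paste)
    have "measure_pmf.prob (pair_pmf (privA_rand \<pi>) (privB_rand \<pi>)) (S \<times> S')
      = measure_pmf.prob (privA_rand \<pi>) S * measure_pmf.prob (privB_rand \<pi>) S'" for S S'
      by (simp add: measure_pmf_prob_product)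
    with rect show "pmf (transcript_pmf \<pi> x y) t = a t x * b t y" for x y t
      using pmf_transcript[of \<pi> x y "fst t" "snd t"] by (simp add: a_def b_def)
  qed
qed

lemma joint_pmf_alt:
  "joint_pmf \<mu> \<pi> = bind_pmf \<mu> (\<lambda>z. map_pmf (Pair z) (transcript_pmf \<pi> (fst z) (snd z)))"
  by (simp add: joint_pmf_def map_pmf_def)

text \<open>Exchanging the finite sum over inputs with the integral puts transcripts outermost, so
  an event can be bounded transcript by transcript.\<close>

lemma prob_joint_pmf:
  fixes \<mu> :: "('x::finite \<times> 'y::finite) pmf"
  shows "measure_pmf.prob (joint_pmf \<mu> \<pi>) S =
    (\<integral>t. (\<Sum>x\<in>UNIV. \<Sum>y\<in>UNIV. pmf \<mu> (x, y) * pmf (transcript_pmf \<pi> x y) t * indicator S ((x, y), t)) \<partial>count_space UNIV)"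
proof -
  let ?K = "\<lambda>z. transcript_pmf \<pi> (fst z) (snd z)"
  have K: "measure_pmf.prob (?K z) (Pair z -` S) = (\<integral>t. pmf (?K z) t * indicator S (z, t) \<partial>count_space UNIV)" for z
  proof -
    have "measure_pmf.prob (?K z) (Pair z -` S) = measure_pmf.expectation (?K z) (indicator (Pair z -` S))"
      by simp
    also have "\<dots> = (\<integral>t. pmf (?K z) t * indicator S (z, t) \<partial>count_space UNIV)"
      by (subst measure_pmf_eq_density, subst integral_density) (auto simp: indicator_def)
    finally show ?thesis .
  qed
  have int: "integrable (count_space UNIV) (\<lambda>t. pmf (?K z) t * indicator S (z, t))" for z
    by (rule Bochner_Integration.integrable_bound[OF integrable_pmf[of UNIV "?K z"]]) (auto simp: indicator_def)
  have "ennreal (measure_pmf.prob (joint_pmf \<mu> \<pi>) S) = (\<integral>\<^sup>+z. ennreal (measure_pmf.prob (?K z) (Pair z -` S)) \<partial>\<mu>)"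
    by (simp add: joint_pmf_alt measure_pmf.emeasure_eq_measure[symmetric])
  also have "\<dots> = ennreal (measure_pmf.expectation \<mu> (\<lambda>z. measure_pmf.prob (?K z) (Pair z -` S)))"
    by (intro nn_integral_eq_integral measure_pmf.integrable_const_bound[where B = 1]) auto
  finally have "measure_pmf.prob (joint_pmf \<mu> \<pi>) S = measure_pmf.expectation \<mu> (\<lambda>z. measure_pmf.prob (?K z) (Pair z -` S))"
    by (subst (asm) ennreal_inj) auto
  also have "\<dots> = (\<Sum>z\<in>UNIV. pmf \<mu> z * measure_pmf.prob (?K z) (Pair z -` S))"
    by (subst integral_measure_pmf[where A = UNIV]) auto
  also have "\<dots> = (\<integral>t. (\<Sum>z\<in>UNIV. pmf \<mu> z * (pmf (?K z) t * indicator S (z, t))) \<partial>count_space UNIV)"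
    unfolding K using int by simp
  finally show ?thesis
    by (simp add: sum.cartesian_product' UNIV_Times_UNIV[symmetric] mult.assoc del: UNIV_Times_UNIV)
qed

text \<open>The minimum is at most the geometric mean of \<open>s\<close> and \<open>t\<close>,
  which is that of \<open>u\<close> and \<open>v\<close>; then AM-GM with weight \<open>d\<close>.
  Being linear in \<open>u\<close> and \<open>v\<close>, the bound can be integrated directly and
  takes the place of Cauchy-Schwarz.\<close>

lemma min_le_weighted_mean:
  fixes u v s t :: real
  assumes "0 \<le> s" "0 \<le> t" "s * t = u * v" "0 \<le> u" "0 \<le> v" "0 < d"
  shows "min s t \<le> (u / d + d * v) / 2"
proof (rule power2_le_imp_le)
  have "(min s t)\<^sup>2 \<le> s * t"
    using assms(1,2) by (auto simp: power2_eq_square min_def intro: mult_mono)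
  also have "\<dots> \<le> ((u / d + d * v) / 2)\<^sup>2"
    using assms(3,6) zero_le_power2[of "u / d - d * v"] by (simp add: power2_eq_square field_simps)
  finally show "(min s t)\<^sup>2 \<le> ((u / d + d * v) / 2)\<^sup>2" .
qed (use assms in simp)

section \<open>Repairing one input pair\<close>

text \<open>The player holding \<open>x\<close> (if \<open>A\<close>) or \<open>y\<close> says whether the input is the special one; only after a
  yes the other player answers too, and two yeses replace the output \<open>z\<close> by \<open>v\<close>.\<close>

definition query :: "'x \<Rightarrow> 'y \<Rightarrow> 'z \<Rightarrow> bool \<Rightarrow> 'z \<Rightarrow> ('x, 'y, 'z) ptree" where
  "query x0 y0 v A z =
    (if z = v then Leaf z
     else if A then ANode (\<lambda>x _. x = x0) (Leaf z) (BNode (\<lambda>y _. y = y0) (Leaf z) (Leaf v))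
     else BNode (\<lambda>y _. y = y0) (Leaf z) (ANode (\<lambda>x _. x = x0) (Leaf z) (Leaf v)))"

text \<open>The path through \<open>query\<close> in closed form. It involves no private randomness,
  so the repaired transcript is a function of the old transcript and the inputs.\<close>

definition query_bits :: "'x \<Rightarrow> 'y \<Rightarrow> 'z \<Rightarrow> bool \<Rightarrow> 'z \<Rightarrow> 'x \<Rightarrow> 'y \<Rightarrow> bool list" where
  "query_bits x0 y0 v A z x y =
    (if z = v then []
     else if (if A then x = x0 else y = y0) then [True, (if A then y = y0 else x = x0)]
     else [False])"

lemma run_bits_query: "run_bits (query x0 y0 v A z) x y ra rb = query_bits x0 y0 v A z x y"
  by (auto simp: query_def query_bits_def Let_def)

lemma leaf_of_query:
  "leaf_of (query x0 y0 v A z) (query_bits x0 y0 v A z x y) = Some (if x = x0 \<and> y = y0 then v else z)"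
  by (auto simp: query_def query_bits_def Let_def)

text \<open>\<open>A\<close> is evaluated on the old transcript, so both players know whose turn it
  is to answer first.\<close>

definition repair :: "'x \<Rightarrow> 'y \<Rightarrow> 'z \<Rightarrow> (transcript \<Rightarrow> bool) \<Rightarrow> ('x, 'y, 'z) protocol \<Rightarrow> ('x, 'y, 'z) protocol" where
  "repair x0 y0 v A \<pi> =
    \<pi>\<lparr>ptree := \<lambda>r. graft (ptree \<pi> r) (\<lambda>w. query x0 y0 v (A (r, w)))\<rparr>"

definition repair_transcript ::
  "'x \<Rightarrow> 'y \<Rightarrow> 'z \<Rightarrow> (transcript \<Rightarrow> bool) \<Rightarrow> ('x, 'y, 'z) protocol \<Rightarrow> 'x \<Rightarrow> 'y \<Rightarrow> transcript \<Rightarrow> transcript" where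
  "repair_transcript x0 y0 v A \<pi> x y t =
    (fst t, snd t @ query_bits x0 y0 v (A t) (output_of \<pi> t) x y)"

lemma transcript_pmf_repair:
  "transcript_pmf (repair x0 y0 v A \<pi>) x y =
    map_pmf (repair_transcript x0 y0 v A \<pi> x y) (transcript_pmf \<pi> x y)"
  by (simp add: transcript_pmf_def transcript_of_def repair_def repair_transcript_def map_bind_pmf
      run_bits_graft run_bits_query output_of_def Let_def)

lemma transcript_pmf_leaf:
  "t \<in> set_pmf (transcript_pmf \<pi> x y) \<Longrightarrow> leaf_of (ptree \<pi> (fst t)) (snd t) \<noteq> None"
  using leaf_of_run_bits by (fastforce simp: transcript_pmf_def transcript_of_def)

lemma output_of_repair:
  assumes "leaf_of (ptree \<pi> (fst t)) (snd t) \<noteq> None"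
  shows "output_of (repair x0 y0 v A \<pi>) (repair_transcript x0 y0 v A \<pi> x y t) =
    (if x = x0 \<and> y = y0 then v else output_of \<pi> t)"
proof -
  obtain z where z: "leaf_of (ptree \<pi> (fst t)) (snd t) = Some z" using assms by blast
  show ?thesis
    by (simp add: output_of_def repair_transcript_def repair_def leaf_of_graft[OF z] z leaf_of_query)
qed

definition error_prob :: "('x, 'y, 'z) protocol \<Rightarrow> ('x \<Rightarrow> 'y \<Rightarrow> 'z) \<Rightarrow> 'x \<Rightarrow> 'y \<Rightarrow> real" where
  "error_prob \<pi> f x y = measure_pmf.prob (transcript_pmf \<pi> x y) {t. output_of \<pi> t \<noteq> f x y}"

text \<open>Two yeses occur only on \<open>(x0, y0)\<close>, so repairs of different pairs do not
  interfere and can be iterated.\<close>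

lemma error_prob_repair:
  "error_prob (repair x0 y0 (f x0 y0) A \<pi>) f x y = (if x = x0 \<and> y = y0 then 0 else error_prob \<pi> f x y)"
proof -
  have "error_prob (repair x0 y0 (f x0 y0) A \<pi>) f x y = measure_pmf.prob (transcript_pmf \<pi> x y)
      {t. (if x = x0 \<and> y = y0 then f x0 y0 else output_of \<pi> t) \<noteq> f x y}"
    unfolding error_prob_def transcript_pmf_repair measure_map_pmf
    by (intro measure_pmf.finite_measure_eq_AE)
      (auto simp: AE_measure_pmf_iff output_of_repair transcript_pmf_leaf)
  then show ?thesis by (auto simp: error_prob_def)
qed

lemma joint_pmf_repair:
  "joint_pmf \<mu> (repair x0 y0 v A \<pi>) =
    map_pmf (\<lambda>z. (fst z, repair_transcript x0 y0 v A \<pi> (fst (fst z)) (snd (fst z)) (snd z))) (joint_pmf \<mu> \<pi>)"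
  by (simp add: joint_pmf_alt transcript_pmf_repair map_bind_pmf pmf.map_comp o_def)

lemma IC_ext_eq:
  fixes \<mu> :: "('x::finite \<times> 'y::finite) pmf"
  shows "IC_ext \<mu> \<pi> = pmf_information (joint_pmf \<mu> \<pi>)"
  unfolding IC_ext_def by (rule mutual_information_pmf)

text \<open>The predicted distribution of the answers: the first one is yes with probability \<open>c\<close>, the
  second one is a fair coin.\<close>

definition guess_bits :: "real \<Rightarrow> bool \<Rightarrow> bool list pmf" where
  "guess_bits c done =
    (if done then return_pmf []
     else bind_pmf (bernoulli_pmf c)
       (\<lambda>b. if b then map_pmf (\<lambda>b'. [True, b']) (bernoulli_pmf (1/2)) else return_pmf [False]))"

lemma pmf_guess_bits:
  assumes "0 \<le> c" "c \<le> 1"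
  shows "pmf (guess_bits c False) [False] = 1 - c" "pmf (guess_bits c False) [True, b] = c / 2"
    "pmf (guess_bits c True) [] = 1"
proof -
  have "inj (\<lambda>b'. [True, b'])" by (auto intro: injI)
  then have "pmf (map_pmf (\<lambda>b'. [True, b']) (bernoulli_pmf (1/2))) [True, b] = 1/2" for b
    by (subst pmf_map_inj') (cases b; simp)+
  moreover have "pmf (map_pmf (\<lambda>b'. [True, b']) (bernoulli_pmf (1/2))) [False] = 0"
    by (auto simp: pmf_eq_0_set_pmf)
  ultimately show "pmf (guess_bits c False) [False] = 1 - c" "pmf (guess_bits c False) [True, b] = c / 2"
    using assms by (simp_all add: guess_bits_def pmf_bind)
qed (simp add: guess_bits_def)

subsection \<open>The cost of repairing a protocol\<close>

text \<open>The event that the first of the two players asked in the repair phase answers yes.\<close>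

definition repair_hit ::
  "'x \<Rightarrow> 'y \<Rightarrow> 'z \<Rightarrow> (transcript \<Rightarrow> bool) \<Rightarrow> ('x, 'y, 'z) protocol \<Rightarrow> (('x \<times> 'y) \<times> transcript) set" where
  "repair_hit x0 y0 v A \<pi> = {((x, y), t). output_of \<pi> t \<noteq> v \<and> (if A t then x = x0 else y = y0)}"

text \<open>\<open>pmf_information_extend\<close> with the answers predicted by
  \<open>guess_bits\<close>: the added terms are the expected log-loss of that prediction.\<close>

lemma IC_ext_repair_le:
  fixes \<mu> :: "('x::finite \<times> 'y::finite) pmf" and \<pi> :: "('x, 'y, 'z) protocol"
  assumes c: "0 < c" "c < 1"
  shows "IC_ext \<mu> (repair x0 y0 v A \<pi>) \<le> IC_ext \<mu> \<pi> + log 2 (1 / (1 - c))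
    + measure_pmf.prob (joint_pmf \<mu> \<pi>) (repair_hit x0 y0 v A \<pi>) * (log 2 ((1 - c) / c) + 1)"
proof -
  let ?J = "joint_pmf \<mu> \<pi>" and ?H = "repair_hit x0 y0 v A \<pi>"
  define G where "G z = repair_transcript x0 y0 v A \<pi> (fst (fst z)) (snd (fst z)) (snd z)" for z
  \<comment> \<open>The loss is \<open>log 2 (1 / (1 - c))\<close> for a no and
    \<open>log 2 (2 / c)\<close> for a yes with its second answer. When nothing is asked, the loss
    of a no is charged as an upper bound.\<close>
  define l where "l z = log 2 (1 / (1 - c)) + indicator ?H z * (log 2 ((1 - c) / c) + 1)" for z
  define guess where "guess t = map_pmf (\<lambda>m. (fst t, snd t @ m)) (guess_bits c (output_of \<pi> t = v))"
    for t :: transcript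
  \<comment> \<open>The old transcript follows its true law; only the answers are guessed, without
    access to the inputs.\<close>
  define R where "R = bind_pmf (map_pmf snd ?J) guess"
  have leaf: "leaf_of (ptree \<pi> (fst (snd z))) (snd (snd z)) \<noteq> None" if "z \<in> set_pmf ?J" for z
    using that by (auto simp: joint_pmf_alt dest: transcript_pmf_leaf)
  \<comment> \<open>Prefix-freeness recovers the old transcript from the extended one.\<close>
  have inj: "inj_on (\<lambda>z. (fst z, G z)) (set_pmf ?J)"
  proof (rule inj_onI)
    fix z z' assume z: "z \<in> set_pmf ?J" "z' \<in> set_pmf ?J" and eq: "(fst z, G z) = (fst z', G z')"
    have "fst (snd z) = fst (snd z')"
      using eq by (simp add: G_def repair_transcript_def)
    moreover have "snd (snd z) = snd (snd z')"
    proof (rule leaf_of_prefix_free[OF leaf[OF z(1)]])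
      show "leaf_of (ptree \<pi> (fst (snd z))) (snd (snd z')) \<noteq> None"
        using leaf[OF z(2)] \<open>fst (snd z) = fst (snd z')\<close> by simp
      show "snd (snd z) @ query_bits x0 y0 v (A (snd z)) (output_of \<pi> (snd z)) (fst (fst z)) (snd (fst z)) =
          snd (snd z') @ query_bits x0 y0 v (A (snd z')) (output_of \<pi> (snd z')) (fst (fst z')) (snd (fst z'))"
        using eq by (auto simp: G_def repair_transcript_def)
    qed
    ultimately show "z = z'" using eq by (simp add: prod_eq_iff)
  qed
  have R_ge: "pmf (map_pmf snd ?J) (snd z) * 2 powr (- l z) \<le> pmf R (G z)" for z
  proof -
    obtain x y t where z: "z = ((x, y), t)" by (cases z) auto
    let ?m = "query_bits x0 y0 v (A t) (output_of \<pi> t) x y"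
    have "inj (\<lambda>m. (fst t, snd t @ m))" by (auto intro: injI)
    then have "pmf (guess t) (G z) = pmf (guess_bits c (output_of \<pi> t = v)) ?m"
      using pmf_map_inj'[of "\<lambda>m. (fst t, snd t @ m)" _ ?m] by (simp add: guess_def G_def repair_transcript_def z)
    moreover have "2 powr (- l z) \<le> pmf (guess_bits c (output_of \<pi> t = v)) ?m"
    proof (cases "z \<in> ?H")
      case True
      have "- l z = log 2 (c / 2)"
        using True c by (simp add: l_def log_divide)
      then have "2 powr (- l z) = c / 2" using c by simp
      moreover have "\<exists>b. ?m = [True, b]" "output_of \<pi> t \<noteq> v"
        using True by (auto simp: z repair_hit_def query_bits_def)
      ultimately show ?thesis using c by (auto simp: pmf_guess_bits)
    next
      case False
      have "- l z = log 2 (1 - c)"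
        using False c by (simp add: l_def log_divide)
      then have "2 powr (- l z) = 1 - c" using c by simp
      moreover have "output_of \<pi> t = v \<or> ?m = [False]"
        using False by (auto simp: z repair_hit_def query_bits_def)
      ultimately show ?thesis using c by (auto simp: pmf_guess_bits query_bits_def)
    qed
    ultimately have "2 powr (- l z) \<le> pmf (guess t) (G z)" by simp
    then have "pmf (map_pmf snd ?J) t * 2 powr (- l z) \<le> pmf (map_pmf snd ?J) t * pmf (guess t) (G z)"
      by (intro mult_left_mono) auto
    also have "\<dots> \<le> pmf R (G z)" unfolding R_def by (rule pmf_bind_ge)
    finally show ?thesis by (simp add: z)
  qed
  have int: "integrable (measure_pmf ?J) (\<lambda>z. indicator ?H z * (log 2 ((1 - c) / c) + 1))"
    by (intro integrable_mult_left measure_pmf.integrable_const_bound[where B = 1]) (auto simp: indicator_def)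
  then have int_l: "integrable (measure_pmf ?J) l"
    unfolding l_def by (intro Bochner_Integration.integrable_add) auto
  have "measure_pmf.expectation ?J l =
      log 2 (1 / (1 - c)) + measure_pmf.prob ?J ?H * (log 2 ((1 - c) / c) + 1)"
    unfolding l_def using int by (subst Bochner_Integration.integral_add) auto
  then show ?thesis
    using pmf_information_extend[OF inj R_ge int_l]
    unfolding IC_ext_eq joint_pmf_repair G_def[symmetric] by simp
qed

text \<open>By the factorization, P(t | x, y0) P(t | x0, y) = P(t | x0, y0) P(t | x, y). So the
  likelihoods of the two possible first yeses multiply to a term \<open>u\<close> of total mass at
  most \<open>e\<close> times a term \<open>W\<close> of total mass at most 1.\<close>

lemma exists_cheap_repair:
  fixes \<mu> :: "('x::finite \<times> 'y::finite) pmf" and \<pi> :: "('x, 'y, 'z) protocol"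
  assumes err: "error_prob \<pi> f x0 y0 \<le> e" and e: "0 < e"
  obtains A where "measure_pmf.prob (joint_pmf \<mu> \<pi>) (repair_hit x0 y0 (f x0 y0) A \<pi>) \<le> sqrt e"
proof -
  let ?K = "transcript_pmf \<pi>" and ?B = "{t. output_of \<pi> t \<noteq> f x0 y0}"
  obtain a :: "transcript \<Rightarrow> 'x \<Rightarrow> real" and b :: "transcript \<Rightarrow> 'y \<Rightarrow> real" where
    nonneg: "\<And>t x. 0 \<le> a t x" "\<And>t y. 0 \<le> b t y"
    and K: "\<And>x y t. pmf (?K x y) t = a t x * b t y"
    using transcript_factorization[of \<pi>] by blast
  define mX where "mX t = (\<Sum>y\<in>UNIV. pmf \<mu> (x0, y) * pmf (?K x0 y) t)" for t
  define mY where "mY t = (\<Sum>x\<in>UNIV. pmf \<mu> (x, y0) * pmf (?K x y0) t)" for t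
  \<comment> \<open>The player for whom yes is less likely given \<open>t\<close> answers first.\<close>
  define A where "A t \<longleftrightarrow> mX t \<le> mY t" for t
  \<comment> \<open>The transcript measure when \<open>x\<close> and \<open>y\<close> are chosen
    independently with weights \<open>pmf \<mu> (x, y0)\<close> and
    \<open>pmf \<mu> (x0, y)\<close>.\<close>
  define W where "W t = (\<Sum>x\<in>UNIV. \<Sum>y\<in>UNIV. pmf \<mu> (x, y0) * pmf \<mu> (x0, y) * pmf (?K x y) t)" for t
  define u where "u t = pmf (?K x0 y0) t * indicator ?B t" for t
  let ?H = "repair_hit x0 y0 (f x0 y0) A \<pi>"
  have int_W: "integrable (count_space UNIV) W"
    unfolding W_def by (intro Bochner_Integration.integrable_sum integrable_mult_right integrable_pmf)
  have int_u: "integrable (count_space UNIV) u"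
    by (rule Bochner_Integration.integrable_bound[OF integrable_pmf[of UNIV "?K x0 y0"]])
      (auto simp: u_def indicator_def)
  have W_le: "(\<integral>t. W t \<partial>count_space UNIV) \<le> 1"
  proof -
    have "(\<integral>t. W t \<partial>count_space UNIV) = (\<Sum>x\<in>UNIV. \<Sum>y\<in>UNIV. pmf \<mu> (x, y0) * pmf \<mu> (x0, y))"
      unfolding W_def by (simp add: integrable_pmf integral_pmf)
    also have "\<dots> = (\<Sum>x\<in>UNIV. pmf \<mu> (x, y0)) * (\<Sum>y\<in>UNIV. pmf \<mu> (x0, y))"
      by (simp add: sum_product)
    also have "\<dots> \<le> 1 * 1"
    proof (intro mult_mono)
      have "(\<Sum>x\<in>UNIV. pmf \<mu> (x, y0)) = measure_pmf.prob \<mu> ((\<lambda>x. (x, y0)) ` UNIV)"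
        by (subst measure_measure_pmf_finite) (auto simp: sum.reindex inj_on_def)
      then show "(\<Sum>x\<in>UNIV. pmf \<mu> (x, y0)) \<le> 1" by simp
      have "(\<Sum>y\<in>UNIV. pmf \<mu> (x0, y)) = measure_pmf.prob \<mu> (Pair x0 ` UNIV)"
        by (subst measure_measure_pmf_finite) (auto simp: sum.reindex inj_on_def)
      then show "(\<Sum>y\<in>UNIV. pmf \<mu> (x0, y)) \<le> 1" by simp
    qed (auto intro: sum_nonneg)
    finally show ?thesis by simp
  qed
  have u_le: "(\<integral>t. u t \<partial>count_space UNIV) \<le> e"
  proof -
    have "error_prob \<pi> f x0 y0 = measure_pmf.expectation (?K x0 y0) (indicator ?B)"
      by (simp add: error_prob_def)
    also have "\<dots> = (\<integral>t. u t \<partial>count_space UNIV)"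
      by (subst measure_pmf_eq_density, subst integral_density) (auto simp: u_def[abs_def] indicator_def)
    finally show ?thesis using err by simp
  qed
  have W_nonneg: "0 \<le> W t" for t
    unfolding W_def by (intro sum_nonneg mult_nonneg_nonneg) auto
  have u_nonneg: "0 \<le> u t" for t
    by (simp add: u_def)
  have hit: "(\<Sum>x\<in>UNIV. \<Sum>y\<in>UNIV. pmf \<mu> (x, y) * pmf (?K x y) t * indicator ?H ((x, y), t))
      = indicator ?B t * min (mX t) (mY t)" for t
  proof (cases "t \<in> ?B")
    case True
    show ?thesis
    proof (cases "A t")
      case A: True
      have "(\<Sum>y\<in>UNIV. pmf \<mu> (x, y) * pmf (?K x y) t * indicator ?H ((x, y), t)) = (if x = x0 then mX t else 0)" for x
        using True A by (simp add: repair_hit_def mX_def indicator_def)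
      with True A show ?thesis by (simp add: A_def min_def)
    next
      case A: False
      have "(\<Sum>y\<in>UNIV. pmf \<mu> (x, y) * pmf (?K x y) t * indicator ?H ((x, y), t)) = pmf \<mu> (x, y0) * pmf (?K x y0) t" for x
        using True A by (simp add: repair_hit_def indicator_def if_distrib cong: if_cong)
      with True A show ?thesis by (simp add: A_def min_def mY_def)
    qed
  next
    case False
    then show ?thesis by (simp add: repair_hit_def indicator_def)
  qed
  \<comment> \<open>The weight \<open>sqrt e\<close> balances the two masses: both halves of the
    mean integrate to at most \<open>sqrt e / 2\<close>.\<close>
  have le: "indicator ?B t * min (mX t) (mY t) \<le> (u t / sqrt e + sqrt e * W t) / 2" for t
  proof (cases "t \<in> ?B")
    case True
    have "mY t * mX t = (\<Sum>x\<in>UNIV. \<Sum>y\<in>UNIV. (pmf \<mu> (x, y0) * pmf (?K x y0) t) * (pmf \<mu> (x0, y) * pmf (?K x0 y) t))"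
      by (simp only: mX_def mY_def sum_product)
    also have "\<dots> = u t * W t"
      unfolding u_def W_def K sum_distrib_left using True
      by (intro sum.cong refl) simp
    finally have "mY t * mX t = u t * W t" .
    then have "mX t * mY t = u t * W t" by (simp add: mult.commute)
    moreover have "0 \<le> mX t" "0 \<le> mY t"
      unfolding mX_def mY_def by (auto intro: sum_nonneg)
    ultimately have "min (mX t) (mY t) \<le> (u t / sqrt e + sqrt e * W t) / 2"
      using W_nonneg u_nonneg e by (intro min_le_weighted_mean) auto
    with True show ?thesis by simp
  next
    case False
    have "0 \<le> (u t / sqrt e + sqrt e * W t) / 2"
      using W_nonneg u_nonneg e by simp
    with False show ?thesis by simp
  qed
  have int_r: "integrable (count_space UNIV) (\<lambda>t. (u t / sqrt e + sqrt e * W t) / 2)"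
    using int_u int_W by simp
  have "measure_pmf.prob (joint_pmf \<mu> \<pi>) ?H = (\<integral>t. indicator ?B t * min (mX t) (mY t) \<partial>count_space UNIV)"
    by (simp only: prob_joint_pmf hit)
  also have "\<dots> \<le> (\<integral>t. (u t / sqrt e + sqrt e * W t) / 2 \<partial>count_space UNIV)"
  proof (rule integral_mono[OF _ int_r le])
    have "norm (indicator ?B t * min (mX t) (mY t)) \<le> norm ((u t / sqrt e + sqrt e * W t) / 2)" for t
    proof -
      have "0 \<le> indicator ?B t * min (mX t) (mY t)"
        unfolding mX_def mY_def by (simp add: sum_nonneg)
      with le[of t] show ?thesis unfolding real_norm_def by linarith
    qed
    then show "integrable (count_space UNIV) (\<lambda>t. indicator ?B t * min (mX t) (mY t))"
      by (intro Bochner_Integration.integrable_bound[OF int_r]) auto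
  qed
  also have "\<dots> = ((\<integral>t. u t \<partial>count_space UNIV) / sqrt e + sqrt e * (\<integral>t. W t \<partial>count_space UNIV)) / 2"
    using int_u int_W by simp
  also have "\<dots> \<le> (e / sqrt e + sqrt e * 1) / 2"
    using u_le W_le e by (intro divide_right_mono add_mono mult_left_mono) auto
  also have "\<dots> = sqrt e"
    using e by (simp add: real_div_sqrt)
  finally show ?thesis by (rule that)
qed

lemma performs_iff_error_prob: "performs \<pi> f \<eta> \<longleftrightarrow> (\<forall>x y. error_prob \<pi> f x y \<le> \<eta>)"
  by (simp add: performs_def error_prob_def)

text \<open>Induction over the set of repaired pairs. Each repair keeps the bound \<open>e\<close>
  on all errors, so every pair costs at most the same amount.\<close>

lemma repair_all_pairs:
  fixes \<mu> :: "('x::finite \<times> 'y::finite) pmf" and \<pi> :: "('x, 'y, 'z) protocol"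
  assumes \<pi>: "performs \<pi> f e" and e: "0 < e" and c: "0 < c" "c \<le> 1/2"
  obtains \<pi>' :: "('x, 'y, 'z) protocol" where "performs \<pi>' f 0"
    and "IC_ext \<mu> \<pi>' \<le> IC_ext \<mu> \<pi>
      + real CARD('x) * real CARD('y) * (log 2 (1 / (1 - c)) + sqrt e * (log 2 ((1 - c) / c) + 1))"
proof -
  let ?C = "log 2 (1 / (1 - c)) + sqrt e * (log 2 ((1 - c) / c) + 1)"
  have "\<exists>\<pi>' :: ('x, 'y, 'z) protocol. performs \<pi>' f e \<and> (\<forall>(x, y)\<in>S. error_prob \<pi>' f x y = 0)
      \<and> IC_ext \<mu> \<pi>' \<le> IC_ext \<mu> \<pi> + real (card S) * ?C" for S :: "('x \<times> 'y) set"
  proof (induction S rule: finite_induct[OF finite])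
    case 1
    show ?case using \<pi> by auto
  next
    case (2 p S)
    obtain x0 y0 where p: "p = (x0, y0)" by (cases p)
    from 2 obtain \<rho> :: "('x, 'y, 'z) protocol" where \<rho>: "performs \<rho> f e"
      "\<forall>(x, y)\<in>S. error_prob \<rho> f x y = 0" "IC_ext \<mu> \<rho> \<le> IC_ext \<mu> \<pi> + real (card S) * ?C"
      by blast
    have "error_prob \<rho> f x0 y0 \<le> e" using \<rho>(1) by (simp add: performs_iff_error_prob)
    then obtain A where A: "measure_pmf.prob (joint_pmf \<mu> \<rho>) (repair_hit x0 y0 (f x0 y0) A \<rho>) \<le> sqrt e"
      using exists_cheap_repair[OF _ e] by metis
    let ?\<rho> = "repair x0 y0 (f x0 y0) A \<rho>"
    \<comment> \<open>Here \<open>c \<le> 1/2\<close> enters: the factor of the hit probability must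
      be nonnegative to insert the bound \<open>sqrt e\<close>.\<close>
    have "0 \<le> log 2 ((1 - c) / c)" using c by (simp add: field_simps)
    then have "measure_pmf.prob (joint_pmf \<mu> \<rho>) (repair_hit x0 y0 (f x0 y0) A \<rho>) * (log 2 ((1 - c) / c) + 1)
        \<le> sqrt e * (log 2 ((1 - c) / c) + 1)"
      using A by (intro mult_right_mono) auto
    moreover have "IC_ext \<mu> ?\<rho> \<le> IC_ext \<mu> \<rho> + log 2 (1 / (1 - c))
        + measure_pmf.prob (joint_pmf \<mu> \<rho>) (repair_hit x0 y0 (f x0 y0) A \<rho>) * (log 2 ((1 - c) / c) + 1)"
      using c by (intro IC_ext_repair_le) auto
    ultimately have "IC_ext \<mu> ?\<rho> \<le> IC_ext \<mu> \<rho> + ?C" by linarith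
    moreover have "real (card (insert p S)) * ?C = real (card S) * ?C + ?C"
      using 2 by (simp add: distrib_right)
    ultimately have "IC_ext \<mu> ?\<rho> \<le> IC_ext \<mu> \<pi> + real (card (insert p S)) * ?C"
      using \<rho>(3) by linarith
    moreover have "performs ?\<rho> f e"
      using \<rho>(1) e by (simp add: performs_iff_error_prob error_prob_repair)
    moreover have "\<forall>(x, y)\<in>insert p S. error_prob ?\<rho> f x y = 0"
      using \<rho>(2) by (auto simp: p error_prob_repair)
    ultimately show ?case by blast
  qed
  from this[of UNIV] obtain \<pi>' :: "('x, 'y, 'z) protocol" where
    "\<forall>x y. error_prob \<pi>' f x y = 0" "IC_ext \<mu> \<pi>' \<le> IC_ext \<mu> \<pi> + real CARD('x \<times> 'y) * ?C"
    by auto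
  then show ?thesis
    by (intro that[of \<pi>']) (simp_all add: performs_iff_error_prob card_cartesian_product flip: UNIV_Times_UNIV)
qed

section \<open>Comparing the repair cost with the binary entropy\<close>

text \<open>Here \<open>- log 2 p\<close> is at least \<open>1 - p\<close>, since
  \<open>ln 2 \<le> 1\<close>, and \<open>- log 2 (1 - p)\<close> is at least 1; the weighted sum is
  \<open>p * (1 - p) + (1 - p)\<close>.\<close>

lemma bin_entropy_ge:
  assumes "1/2 \<le> p" "p < 1"
  shows "1 - p\<^sup>2 \<le> bin_entropy p"
proof -
  have "0 < ln (2::real)" "ln (2::real) \<le> 1"
    using ln_le_minus_one[of "2::real"] by simp_all
  then have "(1 - p) * ln 2 \<le> 1 - p"
    using assms by (simp add: mult_left_le)
  then have "(p - 1) / ln 2 \<le> p - 1"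
    using \<open>0 < ln 2\<close> by (simp add: field_simps)
  then have "log 2 p \<le> p - 1"
    using log2_le_minus_one[of p] assms by simp
  then have "p * log 2 p \<le> p * (p - 1)"
    using assms by (intro mult_left_mono) auto
  moreover have "log 2 (1 - p) \<le> log 2 (1/2)"
    using assms by (intro log_mono) auto
  then have "(1 - p) * log 2 (1 - p) \<le> (1 - p) * (- 1)"
    using assms by (intro mult_left_mono) (auto simp: log_divide)
  ultimately show ?thesis
    by (simp add: bin_entropy_def power2_eq_square algebra_simps)
qed

text \<open>For \<open>d \<le> 1/2\<close> the cost is exactly \<open>bin_entropy d + d\<close>, and
  \<open>d \<le> bin_entropy d\<close>. For larger \<open>d\<close> the coin is fair and the cost
  \<open>1 + d\<close> is below 2, while \<open>4 * (1 - d\<^sup>2)\<close> exceeds 2.\<close>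

lemma repair_cost_le:
  assumes "0 < d" "d\<^sup>2 < 1/2" and c: "c = min d (1/2)"
  shows "log 2 (1 / (1 - c)) + d * (log 2 ((1 - c) / c) + 1) \<le> 4 * bin_entropy d"
proof (cases "d \<le> 1/2")
  case True
  then have c: "c = d" using c by simp
  have "log 2 d \<le> log 2 (1/2)"
    using assms(1) True by (intro log_mono) auto
  then have "d * log 2 d \<le> d * (- 1)"
    using assms(1) by (intro mult_left_mono) (auto simp: log_divide)
  moreover have "(1 - d) * log 2 (1 - d) \<le> 0"
    using assms(1) True by (intro mult_nonneg_nonpos) auto
  ultimately have d: "d \<le> bin_entropy d"
    by (simp add: bin_entropy_def)
  have "log 2 (1 / (1 - c)) + d * (log 2 ((1 - c) / c) + 1) = bin_entropy d + d"
    using assms(1) True unfolding c by (simp add: bin_entropy_def log_divide algebra_simps)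
  also have "\<dots> \<le> 4 * bin_entropy d"
    using d assms(1) by linarith
  finally show ?thesis .
next
  case False
  then have c: "c = 1/2" using c by simp
  have "log 2 (1 / (1 - c)) + d * (log 2 ((1 - c) / c) + 1) = 1 + d"
    unfolding c by simp
  moreover have "d < 1"
    using assms(2) by (intro power2_less_imp_less[of d 1]) auto
  ultimately show ?thesis
    using bin_entropy_ge[of d] assms(2) False by linarith
qed

theorem theorem12:
  fixes f :: "'x::finite \<Rightarrow> 'y::finite \<Rightarrow> 'z::finite"
    and \<mu> :: "('x \<times> 'y) pmf"
    and \<epsilon> :: real
  assumes "0 < \<epsilon>" and "\<epsilon> < 1/2"
  shows "IC_ext_f \<mu> f 0 - IC_ext_f \<mu> f \<epsilon>
           \<le> 4 * real CARD('x) * real CARD('y) * bin_entropy (sqrt \<epsilon>)"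
proof -
  define c where "c = min (sqrt \<epsilon>) (1/2)"
  have c: "0 < c" "c \<le> 1/2" using assms by (simp_all add: c_def)
  have cost: "log 2 (1 / (1 - c)) + sqrt \<epsilon> * (log 2 ((1 - c) / c) + 1) \<le> 4 * bin_entropy (sqrt \<epsilon>)"
    using assms by (intro repair_cost_le) (simp_all add: c_def)
  \<comment> \<open>A real infimum bounds its members from below only if the set is bounded below;
    nonnegativity of information provides this.\<close>
  have bdd: "bdd_below (IC_ext \<mu> ` {\<pi> :: ('x, 'y, 'z) protocol. performs \<pi> f 0})"
    by (rule bdd_belowI2[where m = 0]) (simp add: IC_ext_eq pmf_information_integrable)
  have "IC_ext_f \<mu> f 0 - 4 * real CARD('x) * real CARD('y) * bin_entropy (sqrt \<epsilon>) \<le> IC_ext_f \<mu> f \<epsilon>"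
    unfolding IC_ext_f_def[of \<mu> f \<epsilon>]
  proof (rule cINF_greatest)
    \<comment> \<open>The infimum at error \<open>\<epsilon>\<close> must range over a nonempty set.
      A constant protocol has error at most 1, and repairing all its pairs with \<open>e = 1\<close>
      yields an errorless one.\<close>
    define \<pi>0 :: "('x, 'y, 'z) protocol" where
      "\<pi>0 = \<lparr>pub_rand = return_pmf 0, privA_rand = return_pmf 0, privB_rand = return_pmf 0,
             ptree = \<lambda>_. Leaf undefined\<rparr>"
    have "performs \<pi>0 f 1" by (simp add: performs_def)
    then obtain \<pi> :: "('x, 'y, 'z) protocol" where "performs \<pi> f 0"
      by (rule repair_all_pairs[where c = "1/2"]) auto
    then have "performs \<pi> f \<epsilon>"
      using assms(1) by (meson less_imp_le order_trans performs_def)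
    then show "{\<pi> :: ('x, 'y, 'z) protocol. performs \<pi> f \<epsilon>} \<noteq> {}" by blast
  next
    fix \<pi> :: "('x, 'y, 'z) protocol" assume "\<pi> \<in> {\<pi>. performs \<pi> f \<epsilon>}"
    then have "performs \<pi> f \<epsilon>" by simp
    from repair_all_pairs[OF this assms(1) c]
    obtain \<pi>' :: "('x, 'y, 'z) protocol" where \<pi>': "performs \<pi>' f 0"
      "IC_ext \<mu> \<pi>' \<le> IC_ext \<mu> \<pi>
        + real CARD('x) * real CARD('y) * (log 2 (1 / (1 - c)) + sqrt \<epsilon> * (log 2 ((1 - c) / c) + 1))"
      by blast
    have "IC_ext_f \<mu> f 0 \<le> IC_ext \<mu> \<pi>'"
      unfolding IC_ext_f_def using \<pi>'(1) by (intro cINF_lower[OF bdd]) simp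
    also note \<pi>'(2)
    also have "real CARD('x) * real CARD('y) * (log 2 (1 / (1 - c)) + sqrt \<epsilon> * (log 2 ((1 - c) / c) + 1))
        \<le> real CARD('x) * real CARD('y) * (4 * bin_entropy (sqrt \<epsilon>))"
      using cost by (intro mult_left_mono) auto
    finally show "IC_ext_f \<mu> f 0 - 4 * real CARD('x) * real CARD('y) * bin_entropy (sqrt \<epsilon>) \<le> IC_ext \<mu> \<pi>"
      by (simp add: mult_ac)
  qed
  then show ?thesis by linarith
qed

end
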